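(* Let $n\ge2$ and let $\alpha_1,\alpha_2,\alpha_3\in S_n$ satisfy $\Delta_n^+=\Phi(\alpha_1)\sqcup\Phi(\alpha_2)\sqcup\Phi(\alpha_3)$. Then $$\mathcal C_{\alpha_1,\alpha_2,\alpha_3}=\{(\lambda,\mu,\nu)\in(\mathbb R^{n-1})^3_+\mid \alpha_1^{-1}\lambda+\alpha_2^{-1}\mu+\alpha_3^{-1}\nu=0\}$$ is a simplicial cone.
   Context: $\Delta_n^+=\{(i,j)\mid1\le i<j\le n\}$; for $\alpha\in S_n$, $\Phi(\alpha)=\{(i,j)\in\Delta_n^+\mid\alpha(i)>\alpha(j)\}$; $\sqcup$ is disjoint union (empty sets allowed). Here $\mathbb R^{n-1}$ denotes the quotient $\mathbb R^n/\mathbb R(1,\dots,1)$, with coordinates $a_i=\lambda_i-\lambda_{i+1}$ ($1\le i\le n-1$) for $\lambda=(\lambda_1,\dots,\lambda_n)$, and $S_n$ acts on it by permuting coordinates: $(\alpha^{-1}\lambda)_i=\lambda_{\alpha(i)}$. On $(\mathbb R^{n-1})^3$ the coordinates of $(\lambda,\mu,\nu)$ are $a_i=\lambda_i-\lambda_{i+1}$, $b_i=\mu_i-\mu_{i+1}$, $c_i=\nu_i-\nu_{i+1}$, and $(\mathbb R^{n-1})^3_+$ is the set where all $a_i,b_i,c_i\ge0$. A simplicial cone is a cone generated (with non-negative coefficients) by linearly independent vectors. (These cones are the regular codimension $n-1$ faces, in $(\mathbb R^{n-1})^3$, of the symmetrized Littlewood-Richardson cone.) *)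

theory Defs
  imports "HOL-Analysis.Analysis"
begin

text \<open>
  The index set \<open>{1..n}\<close> is a type \<open>'n\<close> of sort \<open>{finite, linorder}\<close> with \<open>n = CARD('n)\<close>;
  every such type is order isomorphic to \<open>{1..n}\<close>, and every \<open>n \<ge> 1\<close> occurs.
  The type \<open>'n vec_mod_line\<close> is the quotient space \<open>\<real>\<^sup>n / \<real>(1,\<dots>,1)\<close>.
\<close>

definition line_eq :: "real ^ 'n \<Rightarrow> real ^ 'n \<Rightarrow> bool" where
  "line_eq x y \<longleftrightarrow> (\<exists>t. x - y = t *\<^sub>R (\<chi> i. 1))"

lemma line_eq_iff: "line_eq x y \<longleftrightarrow> (\<exists>t. \<forall>i. x $ i = y $ i + t)"
  by (auto simp: line_eq_def vec_eq_iff algebra_simps)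

lemma equivp_line_eq: "equivp line_eq"
proof (rule equivpI)
  show "reflp line_eq"
    by (auto simp: line_eq_iff intro!: reflpI exI[of _ 0])
  show "symp line_eq"
  proof (rule sympI)
    fix x y :: "real ^ 'n"
    assume "line_eq x y"
    then obtain t where "\<forall>i. x $ i = y $ i + t" by (auto simp: line_eq_iff)
    then show "line_eq y x" by (auto simp: line_eq_iff intro!: exI[of _ "- t"])
  qed
  show "transp line_eq"
  proof (rule transpI)
    fix x y z :: "real ^ 'n"
    assume "line_eq x y" "line_eq y z"
    then obtain s t where "\<forall>i. x $ i = y $ i + s" "\<forall>i. y $ i = z $ i + t"
      by (auto simp: line_eq_iff)
    then show "line_eq x z" by (auto simp: line_eq_iff intro!: exI[of _ "t + s"])
  qed
qed

quotient_type (overloaded) 'n vec_mod_line = "(real, 'n::finite) vec" / line_eq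
  by (rule equivp_line_eq)

instantiation vec_mod_line :: (finite) real_vector
begin

lift_definition zero_vec_mod_line :: "'a vec_mod_line" is 0 .

lift_definition plus_vec_mod_line :: "'a vec_mod_line \<Rightarrow> 'a vec_mod_line \<Rightarrow> 'a vec_mod_line"
  is "(+)"
proof -
  fix x x' y y' :: "(real, 'a) vec"
  assume "line_eq x x'" "line_eq y y'"
  then obtain s t where "\<forall>i. x $ i = x' $ i + s" "\<forall>i. y $ i = y' $ i + t"
    by (auto simp: line_eq_iff)
  then show "line_eq (x + y) (x' + y')"
    by (auto simp: line_eq_iff intro!: exI[of _ "s + t"])
qed

lift_definition uminus_vec_mod_line :: "'a vec_mod_line \<Rightarrow> 'a vec_mod_line" is uminus
proof -
  fix x x' :: "(real, 'a) vec"
  assume "line_eq x x'"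
  then obtain s where "\<forall>i. x $ i = x' $ i + s"
    by (auto simp: line_eq_iff)
  then show "line_eq (- x) (- x')"
    by (auto simp: line_eq_iff intro!: exI[of _ "- s"])
qed

lift_definition minus_vec_mod_line :: "'a vec_mod_line \<Rightarrow> 'a vec_mod_line \<Rightarrow> 'a vec_mod_line"
  is "(-)"
proof -
  fix x x' y y' :: "(real, 'a) vec"
  assume "line_eq x x'" "line_eq y y'"
  then obtain s t where "\<forall>i. x $ i = x' $ i + s" "\<forall>i. y $ i = y' $ i + t"
    by (auto simp: line_eq_iff)
  then show "line_eq (x - y) (x' - y')"
    by (auto simp: line_eq_iff intro!: exI[of _ "s - t"])
qed

lift_definition scaleR_vec_mod_line :: "real \<Rightarrow> 'a vec_mod_line \<Rightarrow> 'a vec_mod_line" is scaleR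
proof -
  fix c :: real and x x' :: "(real, 'a) vec"
  assume "line_eq x x'"
  then obtain s where "\<forall>i. x $ i = x' $ i + s"
    by (auto simp: line_eq_iff)
  then show "line_eq (c *\<^sub>R x) (c *\<^sub>R x')"
    by (auto simp: line_eq_iff distrib_left intro!: exI[of _ "c * s"])
qed

instance
proof
  fix x y z :: "'a vec_mod_line" and a b :: real
  have *: "line_eq u v" if "u = v" for u v :: "(real, 'a) vec"
    using that by (auto simp: line_eq_iff intro!: exI[of _ 0])
  show "x + y + z = x + (y + z)" by transfer (rule *, simp)
  show "x + y = y + x" by transfer (rule *, simp)
  show "0 + x = x" by transfer (rule *, simp)
  show "- x + x = 0" by transfer (rule *, simp)
  show "x - y = x + - y" by transfer (rule *, simp)
  show "a *\<^sub>R (x + y) = a *\<^sub>R x + a *\<^sub>R y" by transfer (rule *, simp add: algebra_simps)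
  show "(a + b) *\<^sub>R x = a *\<^sub>R x + b *\<^sub>R x" by transfer (rule *, simp add: algebra_simps)
  show "a *\<^sub>R b *\<^sub>R x = (a * b) *\<^sub>R x" by transfer (rule *, simp)
  show "1 *\<^sub>R x = x" by transfer (rule *, simp)
qed

end

text \<open>\<open>Min {i<..}\<close> is the successor of \<open>i\<close>; it is meaningful only if \<open>i\<close> is not the last index.\<close>

lift_definition coord_diff :: "'n::{finite,linorder} vec_mod_line \<Rightarrow> 'n \<Rightarrow> real"
  is "\<lambda>x i. x $ i - x $ Min {i<..}"
  by (auto simp: line_eq_iff fun_eq_iff)

definition dominant :: "'n::{finite,linorder} vec_mod_line \<Rightarrow> bool" where
  "dominant x \<longleftrightarrow> (\<forall>i < Max UNIV. 0 \<le> coord_diff x i)"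

text \<open>The left action of permutations: \<open>(\<sigma>\<lambda>)\<^sub>i\<close> is the entry of \<open>\<lambda>\<close> at \<open>\<sigma>\<^sup>-\<^sup>1(i)\<close>.\<close>

lift_definition perm_act :: "('n \<Rightarrow> 'n) \<Rightarrow> 'n::finite vec_mod_line \<Rightarrow> 'n vec_mod_line"
  is "\<lambda>\<sigma> x. \<chi> i. x $ inv \<sigma> i"
  by (auto simp: line_eq_iff)

lemma perm_act_inv:
  assumes "\<alpha> permutes UNIV"
  shows "perm_act (inv \<alpha>) (abs_vec_mod_line x) = abs_vec_mod_line (\<chi> i. x $ \<alpha> i)"
  using assms by (simp add: perm_act.abs_eq permutes_inv_inv)

definition pos_pairs :: "('n::linorder \<times> 'n) set" where
  "pos_pairs = {(i, j). i < j}"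

definition inversion_set :: "('n::linorder \<Rightarrow> 'n) \<Rightarrow> ('n \<times> 'n) set" where
  "inversion_set \<alpha> = {(i, j) \<in> pos_pairs. \<alpha> i > \<alpha> j}"

definition cone_C :: "('n::{finite,linorder} \<Rightarrow> 'n) \<Rightarrow> ('n \<Rightarrow> 'n) \<Rightarrow> ('n \<Rightarrow> 'n)
    \<Rightarrow> ('n vec_mod_line \<times> 'n vec_mod_line \<times> 'n vec_mod_line) set" where
  "cone_C \<alpha>\<^sub>1 \<alpha>\<^sub>2 \<alpha>\<^sub>3 = {(x, y, z). dominant x \<and> dominant y \<and> dominant z \<and>
     perm_act (inv \<alpha>\<^sub>1) x + perm_act (inv \<alpha>\<^sub>2) y + perm_act (inv \<alpha>\<^sub>3) z = 0}"

definition simplicial_cone :: "'a::real_vector set \<Rightarrow> bool" where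
  "simplicial_cone C \<longleftrightarrow> (\<exists>B. finite B \<and> independent B \<and>
     C = {\<Sum>v\<in>B. c v *\<^sub>R v | c. \<forall>v\<in>B. 0 \<le> c v})"

end

theory Submission
  imports Defs
begin

text \<open>
  Colour a pair \<open>i < j\<close> by the unique \<open>k\<close> such that \<open>\<alpha>\<^sub>k\<close> inverts it. On the solution space of
  \<open>\<Sum>\<^sub>k \<alpha>\<^sub>k\<^sup>-\<^sup>1 \<lambda>\<^sub>k = 0\<close>, a pair of colour \<open>k\<close> turns into an equation expressing the difference
  \<open>\<lambda>\<^sub>k(\<alpha>\<^sub>k j) - \<lambda>\<^sub>k(\<alpha>\<^sub>k i)\<close> as the sum over \<open>a \<noteq> k\<close> of the differences
  \<open>\<lambda>\<^sub>a(\<alpha>\<^sub>a i) - \<lambda>\<^sub>a(\<alpha>\<^sub>a j)\<close>, all of which are nonnegative on the cone.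
  If moreover \<open>\<alpha>\<^sub>k j\<close> and \<open>\<alpha>\<^sub>k i\<close> are adjacent (a descent of \<open>\<alpha>\<^sub>k\<^sup>-\<^sup>1\<close>), then everything lying between
  \<open>i\<close> and \<open>j\<close> in the order given by \<open>\<alpha>\<^sub>a\<close> also lies in the interval \<open>[i, j]\<close>. By induction on the
  length of this interval, the coordinates at descents are nonnegative combinations of the coordinates
  at the other positions. There are at least \<open>n - 1\<close> descents in total, so comparing dimensions shows
  that the remaining coordinates identify the solution space with a coordinate space and the cone
  with its nonnegative orthant.
\<close>

section \<open>Linear algebra: dual bases and simplicial cones\<close>

text \<open>The \<open>l f\<close> read off the coefficients of a combination of the
  \<open>b e\<close>, which gives independence. By \<open>sep\<close>, every point of
  \<open>V\<close> equals its expansion \<open>\<Sum>e\<in>N. l e x *\<^sub>R b e\<close>, so the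
  \<open>b e\<close> generate the cone.\<close>

lemma simplicial_cone_dual_basis:
  fixes V :: "'a::real_vector set" and l :: "'e \<Rightarrow> 'a \<Rightarrow> real"
  assumes "finite N" and V: "subspace V" and b: "\<And>e. e \<in> N \<Longrightarrow> b e \<in> V"
    and lin: "\<And>e. e \<in> N \<Longrightarrow> linear (l e)"
    and dual: "\<And>e f. e \<in> N \<Longrightarrow> f \<in> N \<Longrightarrow> l f (b e) = (if f = e then 1 else 0)"
    and sep: "\<And>x. x \<in> V \<Longrightarrow> \<forall>e\<in>N. l e x = 0 \<Longrightarrow> x = 0"
  shows "simplicial_cone {x \<in> V. \<forall>e\<in>N. 0 \<le> l e x}"
proof -
  have inj: "inj_on b N"
    by (rule inj_onI) (metis dual zero_neq_one)
  have l_sum: "l f (\<Sum>e\<in>N. g e *\<^sub>R b e) = g f" if "f \<in> N" for f g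
  proof -
    have "l f (\<Sum>e\<in>N. g e *\<^sub>R b e) = (\<Sum>e\<in>N. g e * l f (b e))"
      using lin[OF that] by (simp add: linear_sum linear_cmul)
    also have "\<dots> = (\<Sum>e\<in>N. if f = e then g e else 0)"
      using dual that by (intro sum.cong) auto
    also have "\<dots> = g f"
      using that \<open>finite N\<close> by simp
    finally show ?thesis .
  qed
  have indep: "independent (b ` N)"
  proof (rule independent_if_scalars_zero)
    show "finite (b ` N)"
      using \<open>finite N\<close> by simp
    fix g x
    assume 0: "(\<Sum>x\<in>b ` N. g x *\<^sub>R x) = 0" and "x \<in> b ` N"
    then obtain f where f: "f \<in> N" "x = b f"
      by blast
    have "(\<Sum>e\<in>N. g (b e) *\<^sub>R b e) = 0"
      using 0 by (simp add: sum.reindex[OF inj])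
    then show "g x = 0"
      using l_sum[OF f(1), of "\<lambda>e. g (b e)"] f lin[OF f(1)] by (simp add: linear_0)
  qed
  have "{x \<in> V. \<forall>e\<in>N. 0 \<le> l e x} = {\<Sum>v\<in>b ` N. c v *\<^sub>R v | c. \<forall>v\<in>b ` N. 0 \<le> c v}"
  proof (intro set_eqI iffI)
    fix x assume x: "x \<in> {x \<in> V. \<forall>e\<in>N. 0 \<le> l e x}"
    define c where "c v = l (the_inv_into N b v) x" for v
    have c: "c (b e) = l e x" if "e \<in> N" for e
      using that by (simp add: c_def the_inv_into_f_f[OF inj])
    have "x - (\<Sum>e\<in>N. l e x *\<^sub>R b e) = 0"
    proof (rule sep)
      show "x - (\<Sum>e\<in>N. l e x *\<^sub>R b e) \<in> V"
        using x b V by (auto intro!: subspace_diff subspace_sum subspace_mul)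
      show "\<forall>f\<in>N. l f (x - (\<Sum>e\<in>N. l e x *\<^sub>R b e)) = 0"
        using lin l_sum by (simp add: linear_diff)
    qed
    then have "x = (\<Sum>v\<in>b ` N. c v *\<^sub>R v)"
      using c by (simp add: sum.reindex[OF inj])
    moreover have "\<forall>v\<in>b ` N. 0 \<le> c v"
      using c x by auto
    ultimately show "x \<in> {\<Sum>v\<in>b ` N. c v *\<^sub>R v | c. \<forall>v\<in>b ` N. 0 \<le> c v}"
      by blast
  next
    fix x assume "x \<in> {\<Sum>v\<in>b ` N. c v *\<^sub>R v | c. \<forall>v\<in>b ` N. 0 \<le> c v}"
    then obtain c where x: "x = (\<Sum>e\<in>N. c (b e) *\<^sub>R b e)" and c: "\<forall>e\<in>N. 0 \<le> c (b e)"
      by (auto simp: sum.reindex[OF inj])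
    have "x \<in> V"
      unfolding x using b V by (auto intro!: subspace_sum subspace_mul)
    then show "x \<in> {x \<in> V. \<forall>e\<in>N. 0 \<le> l e x}"
      using c l_sum[of _ "\<lambda>e. c (b e)"] x by simp
  qed
  then show ?thesis
    unfolding simplicial_cone_def using indep \<open>finite N\<close> by blast
qed

text \<open>Since there are at most as many functionals as dimensions, they can serve as coordinates
  of an endomorphism \<open>T\<close>. Separation makes \<open>T\<close> injective, hence
  surjective, and a preimage of a basis vector is the dual vector.\<close>

lemma dual_vector_exists:
  fixes l :: "'j \<Rightarrow> 'a::euclidean_space \<Rightarrow> real"
  assumes "finite J" and "card J \<le> DIM('a)"
    and lin: "\<And>j. j \<in> J \<Longrightarrow> linear (l j)"
    and sep: "\<And>x. \<forall>j\<in>J. l j x = 0 \<Longrightarrow> x = 0"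
    and "j \<in> J"
  shows "\<exists>x. \<forall>j'\<in>J. l j' x = (if j' = j then 1 else 0)"
proof -
  obtain \<phi> where \<phi>: "\<phi> ` J \<subseteq> (Basis :: 'a set)" "inj_on \<phi> J"
    using card_le_inj[OF \<open>finite J\<close> finite_Basis \<open>card J \<le> DIM('a)\<close>] by blast
  define T where "T x = (\<Sum>i\<in>J. l i x *\<^sub>R \<phi> i)" for x
  have T: "T x \<bullet> \<phi> i = l i x" if "i \<in> J" for x i
  proof -
    have "T x \<bullet> \<phi> i = (\<Sum>i'\<in>J. l i' x * (\<phi> i' \<bullet> \<phi> i))"
      by (simp add: T_def inner_sum_left)
    also have "\<dots> = (\<Sum>i'\<in>J. if i = i' then l i' x else 0)"
      using \<phi> that by (intro sum.cong) (auto simp: inner_Basis inj_on_def image_subset_iff)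
    also have "\<dots> = l i x"
      using that \<open>finite J\<close> by simp
    finally show ?thesis .
  qed
  have "linear T"
    unfolding T_def using lin
    by (auto intro!: linearI
        simp: linear_add linear_cmul scaleR_add_left sum.distrib scaleR_sum_right)
  moreover have "inj T"
    unfolding linear_injective_0[OF \<open>linear T\<close>] using sep T by (metis inner_zero_left)
  ultimately obtain x where x: "T x = \<phi> j"
    using linear_injective_imp_surjective by (metis surjD)
  have "l i x = (if i = j then 1 else 0)" if "i \<in> J" for i
  proof -
    have "l i x = \<phi> j \<bullet> \<phi> i"
      using T[OF that, of x] x by simp
    also have "\<dots> = (if i = j then 1 else 0)"
      using \<phi> that \<open>j \<in> J\<close> by (auto simp: inner_Basis image_subset_iff dest: inj_onD)
    finally show ?thesis .
  qed
  then show ?thesis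
    by blast
qed

section \<open>Adjacent positions in a finite linear order\<close>

abbreviation next_pos :: "'n::{finite,linorder} \<Rightarrow> 'n" where
  "next_pos p \<equiv> Min {p<..}"

lemma less_next_pos: "p < Max UNIV \<Longrightarrow> p < next_pos p"
  by (metis Min_in empty_iff finite greaterThan_iff)

lemma next_pos_le: "p < q \<Longrightarrow> next_pos p \<le> q"
  by simp

lemma less_Max_UNIV: "(p::'n::{finite,linorder}) < q \<Longrightarrow> p < Max UNIV"
  by (metis Max_ge UNIV_I finite less_le_trans)

lemma le_if_next_pos_le:
  fixes f :: "'n::{finite,linorder} \<Rightarrow> 'a::preorder"
  assumes "u \<le> w" and step: "\<And>p. u \<le> p \<Longrightarrow> p < w \<Longrightarrow> f (next_pos p) \<le> f p"
  shows "f w \<le> f u"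
  using assms
proof (induction "card {u..w}" arbitrary: u rule: less_induct)
  case less
  show ?case
  proof (cases "u = w")
    case False
    then have uw: "u < w"
      using less.prems by simp
    have u: "u < next_pos u" "next_pos u \<le> w"
      using uw less_next_pos[OF less_Max_UNIV[OF uw]] by auto
    have "{next_pos u..w} \<subset> {u..w}"
      using u uw by (metis atLeastatMost_psubset_iff order.order_iff_strict)
    then have "card {next_pos u..w} < card {u..w}"
      by (intro psubset_card_mono) auto
    then have "f w \<le> f (next_pos u)"
      using less.hyps u less.prems(2) by (meson less_le_trans less_imp_le)
    also have "\<dots> \<le> f u"
      using less.prems(2) uw by simp
    finally show ?thesis .
  qed simp
qed

text \<open>An arbitrary finite family replaces the three permutations, so that every argument is
  uniform in the colour \<open>k\<close>.\<close>

locale inversion_partition =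
  fixes \<alpha> :: "'k::finite \<Rightarrow> 'n::{finite,linorder} \<Rightarrow> 'n"
  assumes bij: "bij (\<alpha> k)"
    and inverted_ex1: "i < j \<Longrightarrow> \<exists>!k. \<alpha> k j < \<alpha> k i"
begin

lemma inverted_unique: "i < j \<Longrightarrow> \<alpha> k j < \<alpha> k i \<Longrightarrow> \<alpha> l j < \<alpha> l i \<Longrightarrow> k = l"
  using inverted_ex1 by blast

lemma eq_iff [simp]: "\<alpha> k i = \<alpha> k j \<longleftrightarrow> i = j"
  using bij[of k] by (metis bij_is_inj injD)

lemma alpha_inv [simp]: "\<alpha> k (inv (\<alpha> k) p) = p"
  using bij[of k] by (simp add: bij_is_surj surj_f_inv_f)

lemma inv_alpha [simp]: "inv (\<alpha> k) (\<alpha> k i) = i"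
  using bij[of k] by (simp add: bij_is_inj inv_f_f)

section \<open>Descent coordinates are controlled by the remaining ones\<close>

definition descents :: "'k \<Rightarrow> 'n set" where
  "descents k = {p. p < Max UNIV \<and> inv (\<alpha> k) (next_pos p) < inv (\<alpha> k) p}"

text \<open>If \<open>m < i\<close>, the colour of \<open>(m, j)\<close> is also the colour of
  \<open>(m, i)\<close>: for colour \<open>k\<close> because no value lies between those of
  \<open>j\<close> and \<open>i\<close>, for any other colour because it keeps \<open>i\<close>
  below \<open>j\<close>. But \<open>(m, i)\<close> has colour \<open>a\<close>, while
  \<open>a\<close> does not invert \<open>(m, j)\<close>. The case \<open>j < m\<close> is
  symmetric.\<close>

lemma between_in_interval:
  assumes p: "p < Max UNIV" and j: "\<alpha> k j = p" and i: "\<alpha> k i = next_pos p" and "i < j"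
    and "a \<noteq> k" and m: "\<alpha> a i \<le> \<alpha> a m" "\<alpha> a m \<le> \<alpha> a j"
  shows "i \<le> m" "m \<le> j"
proof -
  have ij: "\<alpha> k j < \<alpha> k i"
    using i j less_next_pos[OF p] by simp
  have next_le: "\<alpha> k i \<le> \<alpha> k x" if "\<alpha> k j < \<alpha> k x" for x
    using next_pos_le[of p "\<alpha> k x"] i j that by simp
  have not_inv: "\<alpha> b i < \<alpha> b j" if "b \<noteq> k" for b
    using inverted_unique[OF \<open>i < j\<close> ij, of b] that \<open>i < j\<close>
    by (metis eq_iff less_irrefl linorder_neqE)
  show "i \<le> m"
  proof (rule ccontr)
    assume "\<not> i \<le> m"
    then have "m < i" "m < j"
      using \<open>i < j\<close> by auto
    then have mi: "\<alpha> a i < \<alpha> a m"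
      using m by (metis eq_iff less_irrefl order_le_less)
    obtain b where b: "\<alpha> b j < \<alpha> b m"
      using inverted_ex1[OF \<open>m < j\<close>] by blast
    have "\<alpha> b i < \<alpha> b m"
    proof (cases "b = k")
      case True
      then show ?thesis
        using next_le[of m] b \<open>m < i\<close> by (metis eq_iff less_irrefl order_le_less)
    next
      case False
      then show ?thesis
        using not_inv b by (meson less_trans)
    qed
    then have "b = a"
      using inverted_unique[OF \<open>m < i\<close> mi] by simp
    then show False
      using b m by simp
  qed
  show "m \<le> j"
  proof (rule ccontr)
    assume "\<not> m \<le> j"
    then have "j < m" "i < m"
      using \<open>i < j\<close> by auto
    then have jm: "\<alpha> a m < \<alpha> a j"
      using m by (metis eq_iff less_irrefl order_le_less)
    obtain b where b: "\<alpha> b m < \<alpha> b i"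
      using inverted_ex1[OF \<open>i < m\<close>] by blast
    have "\<alpha> b m < \<alpha> b j"
    proof (cases "b = k")
      case True
      have "\<alpha> b m \<noteq> \<alpha> b j" using \<open>j < m\<close> by simp
      then show ?thesis
        using next_le[of m] b True by (metis leD linorder_neqE)
    next
      case False
      then show ?thesis
        using not_inv b by (meson less_trans)
    qed
    then have "b = a"
      using inverted_unique[OF \<open>j < m\<close> jm] by simp
    then show False
      using b m by simp
  qed
qed

lemma antitone_if_nondescents:
  fixes y :: "'k \<Rightarrow> 'n \<Rightarrow> real"
  assumes sum: "\<And>i j. (\<Sum>k\<in>UNIV. y k (\<alpha> k i)) = (\<Sum>k\<in>UNIV. y k (\<alpha> k j))"
    and nondescent: "\<And>k p. p < Max UNIV \<Longrightarrow> p \<notin> descents k \<Longrightarrow> y k (next_pos p) \<le> y k p"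
    and "p < Max UNIV"
  shows "y k (next_pos p) \<le> y k p"
  using \<open>p < Max UNIV\<close>
proof (induction "card {inv (\<alpha> k) (next_pos p)..inv (\<alpha> k) p}" arbitrary: k p rule: less_induct)
  case less
  show ?case
  proof (cases "p \<in> descents k")
    case True
    define i j where "i = inv (\<alpha> k) (next_pos p)" and "j = inv (\<alpha> k) p"
    have ij: "i < j" and i: "\<alpha> k i = next_pos p" and j: "\<alpha> k j = p"
      using True by (auto simp: descents_def i_def j_def)
    have inv: "\<alpha> k j < \<alpha> k i"
      using i j less_next_pos[OF less.prems] by simp
    \<comment> \<open>Each colour \<open>a \<noteq> k\<close> keeps \<open>i\<close> below
      \<open>j\<close>, so the inequality splits into steps between adjacent values. Nondescent
      steps are assumed; descent steps have a smaller interval and fall under the induction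
      hypothesis.\<close>
    have "y a (\<alpha> a j) \<le> y a (\<alpha> a i)" if "a \<noteq> k" for a
    proof (rule le_if_next_pos_le)
      show "\<alpha> a i \<le> \<alpha> a j"
        using inverted_unique[OF ij inv, of a] that by force
      fix r assume r: "\<alpha> a i \<le> r" "r < \<alpha> a j"
      have r_Max: "r < Max UNIV"
        using r(2) by (rule less_Max_UNIV)
      define m' m where "m' = inv (\<alpha> a) (next_pos r)" and "m = inv (\<alpha> a) r"
      show "y a (next_pos r) \<le> y a r"
      proof (cases "r \<in> descents a")
        case True
        have m: "\<alpha> a m = r" "\<alpha> a m' = next_pos r" "m' < m"
          using True by (auto simp: descents_def m'_def m_def)
        have r': "r < next_pos r" "next_pos r \<le> \<alpha> a j"
          using less_next_pos[OF r_Max] next_pos_le[OF r(2)] by auto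
        have "i \<le> m'" "m \<le> j"
          using between_in_interval[OF less.prems j i ij that] r r' m by auto
        moreover have "\<not> (m' = i \<and> m = j)"
          using m r r' by auto
        ultimately have "{m'..m} \<subset> {i..j}"
          using \<open>m' < m\<close> by auto
        then have "card {m'..m} < card {i..j}"
          by (intro psubset_card_mono) auto
        then show ?thesis
          using less.hyps r_Max by (simp add: i_def j_def m'_def m_def)
      qed (use nondescent r_Max in blast)
    qed
    then have "(\<Sum>a\<in>UNIV - {k}. y a (\<alpha> a j)) \<le> (\<Sum>a\<in>UNIV - {k}. y a (\<alpha> a i))"
      by (intro sum_mono) auto
    moreover have "(\<Sum>a\<in>UNIV. y a (\<alpha> a x)) = y k (\<alpha> k x) + (\<Sum>a\<in>UNIV - {k}. y a (\<alpha> a x))" for x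
      by (rule sum.remove) auto
    \<comment> \<open>The full sums at \<open>i\<close> and \<open>j\<close> agree, so the
      inequality for the other colours reverses for colour \<open>k\<close>.\<close>
    ultimately have "y k (\<alpha> k i) \<le> y k (\<alpha> k j)"
      using sum[of i j] by simp
    then show ?thesis
      using i j by simp
  qed (use nondescent less.prems in blast)
qed

section \<open>Counting descents\<close>

text \<open>
  Descents are recorded by their smaller element: enlarging \<open>S\<close> by a new maximum may change the
  predecessor of \<open>i\<close>, but keeps it larger than \<open>i\<close>, so these sets grow with \<open>S\<close>.
\<close>

definition descent_bottoms :: "'k \<Rightarrow> 'n set \<Rightarrow> 'n set" where
  "descent_bottoms k S = {i \<in> S. \<exists>j\<in>S. i < j \<and> \<alpha> k j < \<alpha> k i \<and>
     (\<forall>m\<in>S. \<alpha> k m < \<alpha> k i \<longrightarrow> \<alpha> k m \<le> \<alpha> k j)}"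

lemma descent_bottoms_insert_mono:
  assumes "\<And>x. x \<in> S \<Longrightarrow> x < n"
  shows "descent_bottoms k S \<subseteq> descent_bottoms k (insert n S)"
proof
  fix i assume "i \<in> descent_bottoms k S"
  then obtain j where ij: "i \<in> S" "j \<in> S" "i < j" "\<alpha> k j < \<alpha> k i"
    and max: "\<And>m. m \<in> S \<Longrightarrow> \<alpha> k m < \<alpha> k i \<Longrightarrow> \<alpha> k m \<le> \<alpha> k j"
    by (auto simp: descent_bottoms_def)
  have "i < n" using assms ij by blast
  show "i \<in> descent_bottoms k (insert n S)"
  \<comment> \<open>If \<open>n\<close> falls between \<open>j\<close> and \<open>i\<close> in the
    order of \<open>\<alpha> k\<close>, it becomes the new predecessor of \<open>i\<close>;
    otherwise \<open>j\<close> remains it.\<close>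
  proof (cases "\<alpha> k j < \<alpha> k n \<and> \<alpha> k n < \<alpha> k i")
    case True
    have "\<forall>m\<in>insert n S. \<alpha> k m < \<alpha> k i \<longrightarrow> \<alpha> k m \<le> \<alpha> k n"
      using max True by fastforce
    then show ?thesis
      using ij \<open>i < n\<close> True unfolding descent_bottoms_def by blast
  next
    case False
    then have "\<forall>m\<in>insert n S. \<alpha> k m < \<alpha> k i \<longrightarrow> \<alpha> k m \<le> \<alpha> k j"
      using max by fastforce
    then show ?thesis
      using ij unfolding descent_bottoms_def by blast
  qed
qed

text \<open>Sort the elements \<open>m\<close> of \<open>S\<close> by the colour of
  \<open>(m, n)\<close>. In each nonempty class the element directly above \<open>n\<close> in the
  order of that colour becomes a descent bottom with predecessor \<open>n\<close>. The largest of
  these elements was not a bottom before.\<close>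

lemma descent_bottoms_insert_new:
  assumes "S \<noteq> {}" and S: "\<And>x. x \<in> S \<Longrightarrow> x < n"
  shows "\<exists>l q. q \<in> descent_bottoms l (insert n S) - descent_bottoms l S"
proof -
  define C where "C k = {m \<in> S. \<alpha> k n < \<alpha> k m}" for k
  define first where "first k q \<longleftrightarrow> q \<in> C k \<and> (\<forall>m\<in>C k. \<alpha> k q \<le> \<alpha> k m)" for k q
  have first_ex: "\<exists>q. first k q" if "C k \<noteq> {}" for k
    using ex_min_if_finite[of "\<alpha> k ` C k"] that unfolding first_def
    by (auto simp: not_less)
  have C_ex: "\<exists>k. m \<in> C k" if "m \<in> S" for m
    using inverted_ex1[OF S[OF that]] that by (auto simp: C_def)
  have C_disj: "k = k'" if "m \<in> C k" "m \<in> C k'" for m k k'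
    using inverted_unique[of m n k k'] S that by (auto simp: C_def)
  define Q where "Q = {q. \<exists>k. first k q}"
  have "Q \<noteq> {}"
    using \<open>S \<noteq> {}\<close> C_ex first_ex unfolding Q_def by blast
  define q where "q = Max Q"
  have "q \<in> Q"
    unfolding q_def using \<open>Q \<noteq> {}\<close> by (intro Max_in) auto
  then obtain l where l: "first l q"
    by (auto simp: Q_def)
  have q: "q \<in> S" "\<alpha> l n < \<alpha> l q" "q < n" and q_min: "\<And>m. m \<in> C l \<Longrightarrow> \<alpha> l q \<le> \<alpha> l m"
    using l S by (auto simp: first_def C_def)
  have "\<forall>m\<in>insert n S. \<alpha> l m < \<alpha> l q \<longrightarrow> \<alpha> l m \<le> \<alpha> l n"
    using q_min by (force simp: C_def)
  then have "q \<in> descent_bottoms l (insert n S)"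
    using q unfolding descent_bottoms_def by blast
  moreover have "q \<notin> descent_bottoms l S"
  proof
    assume "q \<in> descent_bottoms l S"
    then obtain j where j: "j \<in> S" "q < j" "\<alpha> l j < \<alpha> l q"
      and max: "\<And>m. m \<in> S \<Longrightarrow> \<alpha> l m < \<alpha> l q \<Longrightarrow> \<alpha> l m \<le> \<alpha> l j"
      by (auto simp: descent_bottoms_def)
    have "j \<notin> C l"
      using q_min j by force
    obtain k where k: "j \<in> C k"
      using C_ex j by blast
    then have "k \<noteq> l"
      using \<open>j \<notin> C l\<close> by blast
    obtain q' where q': "first k q'"
      using first_ex k by blast
    then have "q' \<in> C k" "q' \<in> S" "\<alpha> k n < \<alpha> k q'"
      by (auto simp: first_def C_def)
    have "q' \<le> q"
      unfolding q_def using q' by (intro Max_ge) (auto simp: Q_def)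
    moreover have "q' \<noteq> q"
      using \<open>q' \<in> C k\<close> l \<open>k \<noteq> l\<close> C_disj unfolding first_def by blast
    ultimately have "q' < q" by simp
    \<comment> \<open>The pairs \<open>(q', q)\<close>, \<open>(q, j)\<close>, \<open>(q', j)\<close> have three different colours, which is impossible.\<close>
    have "q \<notin> C k"
      using l \<open>k \<noteq> l\<close> C_disj unfolding first_def by blast
    then have "\<alpha> k q < \<alpha> k q'"
      using q(1) \<open>\<alpha> k n < \<alpha> k q'\<close> by (auto simp: C_def)
    obtain b where b: "\<alpha> b j < \<alpha> b q'"
      using inverted_ex1[OF less_trans[OF \<open>q' < q\<close> \<open>q < j\<close>]] by blast
    \<comment> \<open>\<open>q'\<close> has the lowest \<open>\<alpha> k\<close> value in
      \<open>C k\<close>, which contains \<open>j\<close>.\<close>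
    have "b \<noteq> k"
      using b k q' unfolding first_def by force
    have "q' \<notin> C l"
      using \<open>q' \<in> C k\<close> \<open>k \<noteq> l\<close> C_disj by blast
    then have "\<alpha> l q' \<le> \<alpha> l n"
      using \<open>q' \<in> S\<close> by (auto simp: C_def)
    \<comment> \<open>In the order of \<open>\<alpha> l\<close>, \<open>q'\<close> is not above
      \<open>n\<close>, hence lies below \<open>q\<close>; being in \<open>S\<close>, it is then at
      most the predecessor \<open>j\<close> of \<open>q\<close>.\<close>
    then have "b \<noteq> l"
      using b max[OF \<open>q' \<in> S\<close>] q by (meson leD le_less_trans)
    have "\<not> \<alpha> b j < \<alpha> b q"
      using inverted_unique[OF \<open>q < j\<close> j(3)] \<open>b \<noteq> l\<close> by blast
    then have "\<alpha> b q < \<alpha> b q'"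
      using b by auto
    then show False
      using inverted_unique[OF \<open>q' < q\<close> \<open>\<alpha> k q < \<alpha> k q'\<close>] \<open>b \<noteq> k\<close> by blast
  qed
  ultimately show ?thesis
    by blast
qed

text \<open>When \<open>S\<close> is built up in increasing order, every element after the first
  creates a new bottom in some colour and destroys none.\<close>

lemma card_le_descent_bottoms:
  assumes "S \<noteq> {}"
  shows "card S \<le> Suc (\<Sum>k\<in>UNIV. card (descent_bottoms k S))"
  using finite[of S] assms
proof (induction S rule: finite_linorder_max_induct)
  case (insert n S)
  show ?case
  proof (cases "S = {}")
    case False
    obtain l q where q: "q \<in> descent_bottoms l (insert n S) - descent_bottoms l S"
      using descent_bottoms_insert_new[of S n] False insert.hyps by blast
    have sub: "descent_bottoms k S \<subseteq> descent_bottoms k (insert n S)" for k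
      using descent_bottoms_insert_mono insert.hyps by blast
    have "(\<Sum>k\<in>UNIV. card (descent_bottoms k S)) < (\<Sum>k\<in>UNIV. card (descent_bottoms k (insert n S)))"
    proof (rule sum_strict_mono_ex1)
      show "\<forall>k\<in>UNIV. card (descent_bottoms k S) \<le> card (descent_bottoms k (insert n S))"
        using card_mono[OF finite sub] by blast
      have "card (descent_bottoms l S) < card (descent_bottoms l (insert n S))"
        using sub q by (intro psubset_card_mono) auto
      then show "\<exists>k\<in>UNIV. card (descent_bottoms k S) < card (descent_bottoms k (insert n S))"
        by blast
    qed simp
    moreover have "card (insert n S) = Suc (card S)"
      using insert.hyps by (subst card_insert_disjoint) auto
    ultimately show ?thesis
      using insert.IH[OF False] by simp
  qed simp
qed simp

text \<open>For the full set, the greatest value below \<open>\<alpha> k i\<close> is its immediate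
  predecessor, so bottoms come from genuine descents.\<close>

lemma descent_bottoms_UNIV: "descent_bottoms k UNIV \<subseteq> (\<lambda>p. inv (\<alpha> k) (next_pos p)) ` descents k"
proof
  fix i assume "i \<in> descent_bottoms k UNIV"
  then obtain j where ij: "i < j" "\<alpha> k j < \<alpha> k i"
    and max: "\<And>m. \<alpha> k m < \<alpha> k i \<Longrightarrow> \<alpha> k m \<le> \<alpha> k j"
    by (auto simp: descent_bottoms_def)
  have j_Max: "\<alpha> k j < Max UNIV"
    using ij(2) by (rule less_Max_UNIV)
  have "next_pos (\<alpha> k j) = \<alpha> k i"
  proof (rule ccontr)
    assume "next_pos (\<alpha> k j) \<noteq> \<alpha> k i"
    then have "next_pos (\<alpha> k j) < \<alpha> k i"
      using next_pos_le[OF ij(2)] by simp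
    then have "next_pos (\<alpha> k j) \<le> \<alpha> k j"
      using max[of "inv (\<alpha> k) (next_pos (\<alpha> k j))"] by simp
    then show False
      using less_next_pos[OF j_Max] by simp
  qed
  then show "i \<in> (\<lambda>p. inv (\<alpha> k) (next_pos p)) ` descents k"
    using ij j_Max by (intro image_eqI[of _ _ "\<alpha> k j"]) (auto simp: descents_def)
qed

lemma card_le_descents: "CARD('n) \<le> Suc (\<Sum>k\<in>UNIV. card (descents k))"
proof -
  have "card (descent_bottoms k UNIV) \<le> card (descents k)" for k
    using descent_bottoms_UNIV[of k] by (meson finite surj_card_le)
  then have "(\<Sum>k\<in>UNIV. card (descent_bottoms k UNIV)) \<le> (\<Sum>k\<in>UNIV. card (descents k))"
    by (rule sum_mono)
  then show ?thesis
    using card_le_descent_bottoms[of UNIV] by simp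
qed

section \<open>The solution space and its free coordinates\<close>

definition nondescents :: "('k \<times> 'n) set" where
  "nondescents = {(k, p). p < Max UNIV \<and> p \<notin> descents k}"

text \<open>The defining equation of the cone on representatives: a sum vanishes modulo the line
  exactly when it is constant.\<close>

definition balanced :: "('k \<Rightarrow> 'n \<Rightarrow> real) \<Rightarrow> bool" where
  "balanced y \<longleftrightarrow> (\<forall>i j. (\<Sum>k\<in>UNIV. y k (\<alpha> k i)) = (\<Sum>k\<in>UNIV. y k (\<alpha> k j)))"

lemma balanced_antitone:
  assumes "balanced y" and "\<And>k p. (k, p) \<in> nondescents \<Longrightarrow> y k (next_pos p) \<le> y k p"
    and "p < Max UNIV"
  shows "y k (next_pos p) \<le> y k p"
  using antitone_if_nondescents[of y p k] assms
  unfolding balanced_def nondescents_def by simp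

text \<open>Antitonicity applies to both \<open>y\<close> and its negative.\<close>

lemma balanced_const:
  assumes y: "balanced y" and 0: "\<And>k p. (k, p) \<in> nondescents \<Longrightarrow> y k (next_pos p) = y k p"
  shows "y k p = y k (Max UNIV)"
proof -
  have "balanced (\<lambda>k p. - y k p)"
    using y unfolding balanced_def by (simp add: sum_negf)
  then have "- y k (next_pos p) \<le> - y k p" if "p < Max UNIV" for p
    using balanced_antitone[of "\<lambda>k p. - y k p" p k] 0 that by simp
  moreover have "y k (next_pos p) \<le> y k p" if "p < Max UNIV" for p
    using balanced_antitone[OF y _ that] 0 by simp
  ultimately have step: "y k (next_pos p) = y k p" if "p < Max UNIV" for p
    using that by force
  have "p \<le> Max UNIV" by simp
  then have "y k (Max UNIV) \<le> y k p" "- y k (Max UNIV) \<le> - y k p"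
    using le_if_next_pos_le[of p "Max UNIV" "y k"]
      le_if_next_pos_le[of p "Max UNIV" "\<lambda>p. - y k p"] step by auto
  then show ?thesis by simp
qed

text \<open>The balance equations, the nondescent differences and one normalisation per colour
  separate points by \<open>balanced_const\<close>. The bound on descents ensures that they do not
  outnumber the dimension, so a dual vector exists.\<close>

lemma balanced_dual_exists:
  assumes e: "e \<in> nondescents"
  shows "\<exists>y. balanced y \<and> (\<forall>(k, p)\<in>nondescents.
    y k p - y k (next_pos p) = (if (k, p) = e then 1 else 0))"
proof -
  \<comment> \<open>The coordinates at the last position are added to normalise representatives modulo constants.\<close>
  define L :: "'n + 'k \<times> 'n \<Rightarrow> ((real, 'n) vec, 'k) vec \<Rightarrow> real" where
    "L s v = (case s of
        Inl i \<Rightarrow> (\<Sum>k\<in>UNIV. v $ k $ \<alpha> k i) - (\<Sum>k\<in>UNIV. v $ k $ \<alpha> k (Max UNIV))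
      | Inr (k, p) \<Rightarrow> if p < Max UNIV then v $ k $ p - v $ k $ next_pos p else v $ k $ p)" for s v
  define J :: "('n + 'k \<times> 'n) set" where
    "J = Inl ` (UNIV - {Max UNIV}) \<union> Inr ` (SIGMA k:UNIV. UNIV - descents k)"
  have lin: "linear (L s)" for s
    by (rule linearI)
      (auto simp: L_def sum.distrib sum_distrib_left algebra_simps split: sum.split)
  have nondesc: "Inr (k, p) \<in> J" if "(k, p) \<in> nondescents" for k p
    using that by (auto simp: J_def nondescents_def)
  have bal: "balanced (\<lambda>k p. v $ k $ p)" if "\<And>i. i \<noteq> Max UNIV \<Longrightarrow> L (Inl i) v = 0" for v
  proof -
    have "(\<Sum>k\<in>UNIV. v $ k $ \<alpha> k i) = (\<Sum>k\<in>UNIV. v $ k $ \<alpha> k (Max UNIV))" for i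
      using that[of i] by (cases "i = Max UNIV") (auto simp: L_def)
    then show ?thesis
      unfolding balanced_def by metis
  qed
  have "\<exists>v. \<forall>s\<in>J. L s v = (if s = Inr e then 1 else 0)"
  proof (rule dual_vector_exists)
    show "finite J" by simp
    \<comment> \<open>The \<open>n - 1\<close> balance equations are offset by the at least
      \<open>n - 1\<close> omitted descents. The last position is never a descent, so the
      normalising functionals are included.\<close>
    have "card J = (CARD('n) - 1) + (\<Sum>k\<in>UNIV. card (UNIV - descents k))"
      unfolding J_def by (subst card_Un_disjoint) (auto simp: card_image card_SigmaI)
    moreover have "(\<Sum>k\<in>UNIV. card (UNIV - descents k)) + (\<Sum>k\<in>UNIV. card (descents k))
        = (\<Sum>k\<in>(UNIV :: 'k set). CARD('n))"
      unfolding sum.distrib[symmetric]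
      by (intro sum.cong refl) (simp add: card_Diff_subset card_mono)
    ultimately show "card J \<le> DIM(((real, 'n) vec, 'k) vec)"
      using card_le_descents by simp
    show "linear (L s)" for s
      by (rule lin)
    show "Inr e \<in> J"
      using nondesc e by (cases e) auto
    fix v assume 0: "\<forall>s\<in>J. L s v = 0"
    have "balanced (\<lambda>k p. v $ k $ p)"
      using 0 by (intro bal) (auto simp: J_def)
    moreover have "v $ k $ next_pos p = v $ k $ p" if "(k, p) \<in> nondescents" for k p
      using 0[rule_format, OF nondesc[OF that]] that by (auto simp: L_def nondescents_def)
    ultimately have "v $ k $ p = v $ k $ Max UNIV" for k p
      by (rule balanced_const)
    moreover have "v $ k $ Max UNIV = 0" for k
      using 0[rule_format, of "Inr (k, Max UNIV)"] by (auto simp: L_def J_def descents_def)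
    ultimately show "v = 0"
      by (simp add: vec_eq_iff)
  qed
  then obtain v where v: "\<And>s. s \<in> J \<Longrightarrow> L s v = (if s = Inr e then 1 else 0)"
    by blast
  have "balanced (\<lambda>k p. v $ k $ p)"
    using v by (intro bal) (auto simp: J_def)
  moreover have "v $ k $ p - v $ k $ next_pos p = (if (k, p) = e then 1 else 0)"
    if "(k, p) \<in> nondescents" for k p
    using v[OF nondesc[OF that]] that by (auto simp: L_def nondescents_def)
  ultimately show ?thesis
    by blast
qed

end

section \<open>Computing in the quotient with representatives\<close>

definition vec_class :: "('n::finite \<Rightarrow> real) \<Rightarrow> 'n vec_mod_line" where
  "vec_class f = abs_vec_mod_line (\<chi> i. f i)"

lemma vec_class_surj: "\<exists>f. x = vec_class f"
proof (induction x rule: vec_mod_line.abs_induct)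
  case (1 v)
  then show ?case
    unfolding vec_class_def by (intro exI[of _ "\<lambda>i. v $ i"]) simp
qed

lemma vec_class_eq_0_iff: "vec_class f = 0 \<longleftrightarrow> (\<forall>i j. f i = f j)"
proof -
  have "vec_class f = 0 \<longleftrightarrow> (\<exists>t. \<forall>i. f i = t)"
    by (simp add: vec_class_def zero_vec_mod_line_def vec_mod_line.abs_eq_iff line_eq_iff)
  then show ?thesis
    by metis
qed

lemma vec_class_add: "vec_class f + vec_class g = vec_class (\<lambda>i. f i + g i)"
proof -
  have "(\<chi> i. f i) + (\<chi> i. g i) = (\<chi> i. f i + g i)"
    by (simp add: vec_eq_iff)
  then show ?thesis
    by (simp add: vec_class_def plus_vec_mod_line.abs_eq)
qed

lemma vec_class_scaleR: "c *\<^sub>R vec_class f = vec_class (\<lambda>i. c * f i)"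
proof -
  have "c *\<^sub>R (\<chi> i. f i) = (\<chi> i. c * f i)"
    by (simp add: vec_eq_iff)
  then show ?thesis
    by (simp add: vec_class_def scaleR_vec_mod_line.abs_eq)
qed

lemma coord_diff_vec_class: "coord_diff (vec_class f) p = f p - f (next_pos p)"
  by (simp add: vec_class_def coord_diff.abs_eq)

lemma perm_act_vec_class:
  "\<alpha> permutes UNIV \<Longrightarrow> perm_act (inv \<alpha>) (vec_class f) = vec_class (\<lambda>i. f (\<alpha> i))"
  by (simp add: vec_class_def perm_act_inv)

lemma linear_coord_diff: "linear (\<lambda>x. coord_diff x p)"
proof (rule linearI)
  fix x y :: "'a vec_mod_line" and c :: real
  obtain f g where [simp]: "x = vec_class f" "y = vec_class g"
    using vec_class_surj by metis
  show "coord_diff (x + y) p = coord_diff x p + coord_diff y p"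
    by (simp add: vec_class_add coord_diff_vec_class)
  show "coord_diff (c *\<^sub>R x) p = c *\<^sub>R coord_diff x p"
    by (simp add: vec_class_scaleR coord_diff_vec_class algebra_simps)
qed

lemma linear_perm_act_inv:
  assumes "\<alpha> permutes UNIV"
  shows "linear (perm_act (inv \<alpha>))"
proof (rule linearI)
  fix x y :: "'a vec_mod_line" and c :: real
  obtain f g where [simp]: "x = vec_class f" "y = vec_class g"
    using vec_class_surj by metis
  show "perm_act (inv \<alpha>) (x + y) = perm_act (inv \<alpha>) x + perm_act (inv \<alpha>) y"
    by (simp add: vec_class_add perm_act_vec_class assms)
  show "perm_act (inv \<alpha>) (c *\<^sub>R x) = c *\<^sub>R perm_act (inv \<alpha>) x"
    by (simp add: vec_class_scaleR perm_act_vec_class assms)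
qed

section \<open>The cone of three permutations\<close>

definition component :: "3 \<Rightarrow> 'a \<times> 'a \<times> 'a \<Rightarrow> 'a" where
  "component k t = (if k = 1 then fst t else if k = 2 then fst (snd t) else snd (snd t))"

lemma linear_component: "linear (component k)"
  by (rule linearI) (auto simp: component_def)

lemma component_simps [simp]:
  "component 1 (x, y, z) = x" "component 2 (x, y, z) = y" "component 3 (x, y, z) = z"
  by (auto simp: component_def)

theorem corollary8p2:
  fixes \<alpha>\<^sub>1 \<alpha>\<^sub>2 \<alpha>\<^sub>3 :: "'n::{finite,linorder} \<Rightarrow> 'n"
  assumes "CARD('n) \<ge> 2"
    and "\<alpha>\<^sub>1 permutes UNIV" "\<alpha>\<^sub>2 permutes UNIV" "\<alpha>\<^sub>3 permutes UNIV"
    and "pos_pairs = inversion_set \<alpha>\<^sub>1 \<union> inversion_set \<alpha>\<^sub>2 \<union> inversion_set \<alpha>\<^sub>3"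
    and "inversion_set \<alpha>\<^sub>1 \<inter> inversion_set \<alpha>\<^sub>2 = {}"
    and "inversion_set \<alpha>\<^sub>1 \<inter> inversion_set \<alpha>\<^sub>3 = {}"
    and "inversion_set \<alpha>\<^sub>2 \<inter> inversion_set \<alpha>\<^sub>3 = {}"
  shows "simplicial_cone (cone_C \<alpha>\<^sub>1 \<alpha>\<^sub>2 \<alpha>\<^sub>3)"
proof -
  define \<alpha> :: "3 \<Rightarrow> 'n \<Rightarrow> 'n" where "\<alpha> k = component k (\<alpha>\<^sub>1, \<alpha>\<^sub>2, \<alpha>\<^sub>3)" for k
  have \<alpha>_simps [simp]: "\<alpha> 1 = \<alpha>\<^sub>1" "\<alpha> 2 = \<alpha>\<^sub>2" "\<alpha> 3 = \<alpha>\<^sub>3"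
    by (simp_all add: \<alpha>_def)
  \<comment> \<open>The union of the inversion sets gives existence of the colour, their
    disjointness its uniqueness.\<close>
  interpret inversion_partition \<alpha>
  proof
    show "bij (\<alpha> k)" for k
      using exhaust_3[of k] assms(2-4) by (auto intro: permutes_bij)
    fix i j :: 'n assume "i < j"
    then have inv: "(i, j) \<in> inversion_set \<beta> \<longleftrightarrow> \<beta> j < \<beta> i" for \<beta> :: "'n \<Rightarrow> 'n"
      by (auto simp: inversion_set_def pos_pairs_def)
    have "(i, j) \<in> pos_pairs"
      using \<open>i < j\<close> by (simp add: pos_pairs_def)
    then have "\<exists>k. \<alpha> k j < \<alpha> k i"
      unfolding assms(5) Un_iff inv by (metis \<alpha>_simps)
    moreover have "k = l" if "\<alpha> k j < \<alpha> k i" "\<alpha> l j < \<alpha> l i" for k l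
      using assms(6-8) exhaust_3[of k] exhaust_3[of l] that
      unfolding disjoint_iff by (auto simp flip: inv)
    ultimately show "\<exists>!k. \<alpha> k j < \<alpha> k i"
      by blast
  qed
  define classes :: "(3 \<Rightarrow> 'n \<Rightarrow> real) \<Rightarrow> 'n vec_mod_line \<times> 'n vec_mod_line \<times> 'n vec_mod_line"
    where "classes y = (vec_class (y 1), vec_class (y 2), vec_class (y 3))" for y
  have classes_surj: "\<exists>y. t = classes y" for t
  proof -
    have "\<exists>f. \<forall>k. component k t = vec_class (f k)"
      by (intro choice allI vec_class_surj)
    then show ?thesis
      unfolding classes_def by (cases t) (metis component_simps)
  qed
  have component_classes: "component k (classes y) = vec_class (y k)" for k y
    using exhaust_3[of k] by (auto simp: classes_def)
  define V where "V = {(x, y, z).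
    perm_act (inv \<alpha>\<^sub>1) x + perm_act (inv \<alpha>\<^sub>2) y + perm_act (inv \<alpha>\<^sub>3) z = 0}"
  have V_iff: "classes y \<in> V \<longleftrightarrow> balanced y" for y
    using assms(2-4)
    by (simp add: V_def classes_def perm_act_vec_class vec_class_add vec_class_eq_0_iff
        balanced_def sum_3)
  define l where "l = (\<lambda>(k, p) t. coord_diff (component k t :: 'n vec_mod_line) p)"
  have l_classes: "l (k, p) (classes y) = y k p - y k (next_pos p)" for k p y
    by (simp add: l_def component_classes coord_diff_vec_class)
  \<comment> \<open>The classes of the dual families will generate the cone, one generator for each
    nondescent.\<close>
  have "\<exists>b. \<forall>e\<in>nondescents. b e \<in> V \<and> (\<forall>f\<in>nondescents. l f (b e) = (if f = e then 1 else 0))"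
  proof (intro bchoice ballI)
    fix e assume "e \<in> nondescents"
    from balanced_dual_exists[OF this] obtain y where "balanced y"
      and "\<forall>(k, p)\<in>nondescents. y k p - y k (next_pos p) = (if (k, p) = e then 1 else 0)"
      by blast
    then show "\<exists>b. b \<in> V \<and> (\<forall>f\<in>nondescents. l f b = (if f = e then 1 else 0))"
      by (intro exI[of _ "classes y"]) (auto simp: V_iff l_classes)
  qed
  then obtain b where b: "\<And>e. e \<in> nondescents \<Longrightarrow> b e \<in> V"
    "\<And>e f. e \<in> nondescents \<Longrightarrow> f \<in> nondescents \<Longrightarrow> l f (b e) = (if f = e then 1 else 0)"
    by blast
  have "simplicial_cone {t \<in> V. \<forall>e\<in>nondescents. 0 \<le> l e t}"
  proof (rule simplicial_cone_dual_basis[where b = b])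
    have "linear (\<lambda>t. perm_act (inv \<alpha>\<^sub>1) (component 1 t) + perm_act (inv \<alpha>\<^sub>2) (component 2 t)
        + perm_act (inv \<alpha>\<^sub>3) (component 3 t))"
      using assms(2-4)
      by (intro linear_compose_add linear_compose[OF linear_component, unfolded o_def]
          linear_perm_act_inv)
    from linear_subspace_kernel[OF this] show "subspace V"
      by (simp add: V_def case_prod_unfold component_def)
    show "linear (l e)" for e
      using linear_compose[OF linear_component linear_coord_diff]
      by (auto simp: l_def o_def split: prod.split)
    fix t assume "t \<in> V" and 0: "\<forall>e\<in>nondescents. l e t = 0"
    obtain y where t: "t = classes y"
      using classes_surj by blast
    have "y k p = y k (Max UNIV)" for k p
    proof (rule balanced_const)
      show "balanced y"
        using \<open>t \<in> V\<close> by (simp add: t V_iff)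
      show "y k (next_pos p) = y k p" if "(k, p) \<in> nondescents" for k p
        using bspec[OF 0 that] by (simp add: t l_classes)
    qed
    then have "vec_class (y k) = 0" for k
      unfolding vec_class_eq_0_iff by metis
    then show "t = 0"
      by (simp add: t classes_def zero_prod_def)
  qed (use b in auto)
  also have "{t \<in> V. \<forall>e\<in>nondescents. 0 \<le> l e t} = cone_C \<alpha>\<^sub>1 \<alpha>\<^sub>2 \<alpha>\<^sub>3"
  proof (rule set_eqI)
    fix t
    obtain y where t: "t = classes y"
      using classes_surj by blast
    have "t \<in> cone_C \<alpha>\<^sub>1 \<alpha>\<^sub>2 \<alpha>\<^sub>3 \<longleftrightarrow> t \<in> V \<and> (\<forall>k. \<forall>p < Max UNIV. 0 \<le> l (k, p) t)"
      by (cases t) (auto simp: cone_C_def V_def dominant_def l_def forall_3)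
    \<comment> \<open>On \<open>V\<close>, the inequalities at descents follow from those at
      nondescents.\<close>
    also have "\<dots> \<longleftrightarrow> t \<in> V \<and> (\<forall>e\<in>nondescents. 0 \<le> l e t)"
      using balanced_antitone[of y] by (auto simp: t V_iff l_classes nondescents_def)
    finally show "t \<in> {t \<in> V. \<forall>e\<in>nondescents. 0 \<le> l e t} \<longleftrightarrow> t \<in> cone_C \<alpha>\<^sub>1 \<alpha>\<^sub>2 \<alpha>\<^sub>3"
      by simp
  qed
  finally show ?thesis .
qed

end
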